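(* Let $\mathcal{F}$ be a sequence of $n$ conditional events and let $(s_1,s_2,s_3,s_4,s_5,s_6)$ be a hexagon of opposition, with $s_k:(\mathcal{F},\mathcal{I}_k)$, $\mathcal{I}_k\subseteq[0,1]^n$, $k=1,\ldots,6$. Then all relations of the square of opposition $(s_1,s_2,s_3,s_4)$ hold ($s_1,s_2$ are contraries; $s_3,s_4$ are subcontraries; $s_1,s_4$ are contradictories and $s_2,s_3$ are contradictories; $s_3$ is a subaltern of $s_1$ and $s_4$ is a subaltern of $s_2$), and moreover: (i) $s_1$ and $s_6$ are contraries; (ii) $s_2$ and $s_6$ are contraries; (iii) $s_3$ is a subaltern of $s_6$; (iv) $s_4$ is a subaltern of $s_6$; (v) $s_5$ is a subaltern of $s_1$; (vi) $s_5$ is a subaltern of $s_2$; (vii) $s_5$ and $s_3$ are subcontraries; (viii) $s_5$ and $s_4$ are subcontraries; (ix) $s_5$ and $s_6$ are contradictories.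
   Context: Events are two-valued logical entities (they can be modelled as subsets of a nonempty set $\Omega$ of possible cases); an event is identified with its indicator in $\{0,1\}$. A conditional event $E|H$ is given by events $E,H$ with $H\neq\bot$ (impossible event). Given $\mathcal{F}=(E_1|H_1,\ldots,E_n|H_n)$, a precise assessment on $\mathcal{F}$ is a vector $\mathcal{P}=(p_1,\ldots,p_n)$, $p_i=p(E_i|H_i)$. It is coherent iff for every nonempty subfamily, indexed by $J\subseteq\{1,\ldots,n\}$, and all real numbers $s_j$ ($j\in J$), the random gain $\mathcal{G}=\sum_{j\in J}s_jH_j(E_j-p_j)$ satisfies $\min G\le 0\le\max G$, where $G$ is the set of values of $\mathcal{G}$ restricted to $\bigvee_{j\in J}H_j$ being true. $\Pi$ denotes the set of all coherent precise assessments on $\mathcal{F}$; it is known that $\emptyset\neq\Pi\subseteq[0,1]^n$. An imprecise assessment on $\mathcal{F}$ is any (possibly empty) subset $\mathcal{I}\subseteq[0,1]^n$; write $\pi(\mathcal{I})=\Pi\cap\mathcal{I}$. A sentence is a pair $s:(\mathcal{F},\mathcal{I})$; it is acceptable iff $\pi(\mathcal{I})\neq\emptyset$. Operations: $s_1\wedge s_2:(\mathcal{F},\mathcal{I}_1\cap\mathcal{I}_2)$, $s_1\vee s_2:(\mathcal{F},\mathcal{I}_1\cup\mathcal{I}_2)$, $\overline{s}:(\mathcal{F},[0,1]^n\setminus\mathcal{I})$. Sentences $s:(\mathcal{F},\mathcal{I})$ and $s':(\mathcal{F},\mathcal{I}')$ are equivalent under t-coherence, $s\equiv s'$, iff $\pi(\mathcal{I})=\pi(\mathcal{I}')$.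 Relations between sentences $s,s'$ on $\mathcal{F}$: they are contraries iff $s\wedge s'$ is not acceptable; subcontraries iff $\overline{s}\wedge\overline{s'}$ is not acceptable; contradictories iff they are both contraries and subcontraries; $s'$ is a subaltern of $s$ iff $s\wedge\overline{s'}$ is not acceptable. A quadruple $(s_1,s_2,s_3,s_4)$ of sentences on $\mathcal{F}$ is a square of opposition iff (a) $s_1,s_2$ are contraries; (b) $s_3,s_4$ are subcontraries; (c) $s_1,s_4$ are contradictories and $s_2,s_3$ are contradictories; (d) $s_3$ is a subaltern of $s_1$ and $s_4$ is a subaltern of $s_2$. A tuple $(s_1,\ldots,s_6)$ of sentences on $\mathcal{F}$ is a hexagon of opposition iff $(s_1,s_2,s_3,s_4)$ is a square of opposition, $s_5\equiv s_1\vee s_2$, and $s_6\equiv s_3\wedge s_4$. *)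

theory Defs
  imports "HOL-Analysis.Finite_Cartesian_Product" "HOL-Library.Indicator_Function"
begin

text \<open>
  The possible cases are the elements of the type \<open>'w\<close> and events are sets of them.
  The pair \<open>(E, H)\<close> stands for the conditional event \<open>E|H\<close>; the requirement that \<open>H\<close> is not
  the impossible event is the predicate \<open>cond_event\<close>. A sequence of \<open>n\<close> conditional events
  is a function on a finite index type \<open>'n\<close> with \<open>n = CARD('n)\<close>.
\<close>

type_synonym 'w cevent = "'w set \<times> 'w set"

type_synonym ('w, 'n) family = "'n \<Rightarrow> 'w cevent"

definition cond_event :: "'w cevent \<Rightarrow> bool" where
  "cond_event C \<longleftrightarrow> snd C \<noteq> {}"

definition gain ::
  "('w, 'n::finite) family \<Rightarrow> real ^ 'n \<Rightarrow> 'n set \<Rightarrow> ('n \<Rightarrow> real) \<Rightarrow> 'w \<Rightarrow> real" where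
  "gain F p J s w =
     (\<Sum>j\<in>J. s j * indicator (snd (F j)) w * (indicator (fst (F j)) w - p $ j))"

definition gain_values ::
  "('w, 'n::finite) family \<Rightarrow> real ^ 'n \<Rightarrow> 'n set \<Rightarrow> ('n \<Rightarrow> real) \<Rightarrow> real set" where
  "gain_values F p J s = gain F p J s ` (\<Union>j\<in>J. snd (F j))"

text \<open>\<open>Min\<close> and \<open>Max\<close> are only meaningful on finite nonempty sets; the two lemmas below
  show that the sets of gain values are of this kind, even if there are infinitely many
  possible cases.\<close>

definition coherent :: "('w, 'n::finite) family \<Rightarrow> real ^ 'n \<Rightarrow> bool" where
  "coherent F p \<longleftrightarrow>
     (\<forall>J s. J \<noteq> {} \<longrightarrow> Min (gain_values F p J s) \<le> 0 \<and> 0 \<le> Max (gain_values F p J s))"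

lemma finite_gain_values:
  fixes F :: "('w, 'n::finite) family"
  shows "finite (gain_values F p J s)"
proof -
  let ?g = "\<lambda>b :: 'n \<Rightarrow> bool \<times> bool.
    \<Sum>j\<in>J. s j * of_bool (fst (b j)) * (of_bool (snd (b j)) - p $ j)"
  have "gain F p J s w \<in> range ?g" for w
    by (rule range_eqI[where x = "\<lambda>j. (w \<in> snd (F j), w \<in> fst (F j))"])
      (simp add: gain_def indicator_def)
  then have "gain_values F p J s \<subseteq> range ?g"
    by (simp add: gain_values_def image_subset_iff)
  then show ?thesis
    by (rule finite_subset) simp
qed

lemma gain_values_nonempty:
  assumes "\<forall>j. cond_event (F j)" and "J \<noteq> {}"
  shows "gain_values F p J s \<noteq> {}"
  using assms by (auto simp: gain_values_def cond_event_def)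

definition coherent_assessments :: "('w, 'n::finite) family \<Rightarrow> (real ^ 'n) set" where
  "coherent_assessments F = {p. coherent F p}"

definition unit_cube :: "(real ^ 'n::finite) set" where
  "unit_cube = {p. \<forall>i. 0 \<le> p $ i \<and> p $ i \<le> 1}"

text \<open>
  A sentence is a pair of a family and an imprecise assessment on it. The binary operations
  and relations are meant for sentences on one and the same family, which is read off the
  first argument of the operations.
\<close>

type_synonym ('w, 'n) sentence = "('w, 'n) family \<times> (real ^ 'n) set"

definition coherent_part :: "('w, 'n::finite) sentence \<Rightarrow> (real ^ 'n) set" where
  "coherent_part s = coherent_assessments (fst s) \<inter> snd s"

definition acceptable :: "('w, 'n::finite) sentence \<Rightarrow> bool" where
  "acceptable s \<longleftrightarrow> coherent_part s \<noteq> {}"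

definition sand :: "('w, 'n::finite) sentence \<Rightarrow> ('w, 'n) sentence \<Rightarrow> ('w, 'n) sentence" where
  "sand s s' = (fst s, snd s \<inter> snd s')"

definition sor :: "('w, 'n::finite) sentence \<Rightarrow> ('w, 'n) sentence \<Rightarrow> ('w, 'n) sentence" where
  "sor s s' = (fst s, snd s \<union> snd s')"

definition snot :: "('w, 'n::finite) sentence \<Rightarrow> ('w, 'n) sentence" where
  "snot s = (fst s, unit_cube - snd s)"

definition sequiv :: "('w, 'n::finite) sentence \<Rightarrow> ('w, 'n) sentence \<Rightarrow> bool" where
  "sequiv s s' \<longleftrightarrow> coherent_part s = coherent_part s'"

definition contraries :: "('w, 'n::finite) sentence \<Rightarrow> ('w, 'n) sentence \<Rightarrow> bool" where
  "contraries s s' \<longleftrightarrow> \<not> acceptable (sand s s')"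

definition subcontraries :: "('w, 'n::finite) sentence \<Rightarrow> ('w, 'n) sentence \<Rightarrow> bool" where
  "subcontraries s s' \<longleftrightarrow> \<not> acceptable (sand (snot s) (snot s'))"

definition contradictories :: "('w, 'n::finite) sentence \<Rightarrow> ('w, 'n) sentence \<Rightarrow> bool" where
  "contradictories s s' \<longleftrightarrow> contraries s s' \<and> subcontraries s s'"

text \<open>Argument order: \<open>subaltern s' s\<close> reads ``\<open>s'\<close> is a subaltern of \<open>s\<close>''.\<close>

definition subaltern :: "('w, 'n::finite) sentence \<Rightarrow> ('w, 'n) sentence \<Rightarrow> bool" where
  "subaltern s' s \<longleftrightarrow> \<not> acceptable (sand s (snot s'))"

definition square_of_opposition ::
  "('w, 'n::finite) sentence \<Rightarrow> ('w, 'n) sentence \<Rightarrow> ('w, 'n) sentence \<Rightarrow> ('w, 'n) sentence \<Rightarrow> bool"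
where
  "square_of_opposition s1 s2 s3 s4 \<longleftrightarrow>
     contraries s1 s2 \<and> subcontraries s3 s4 \<and>
     contradictories s1 s4 \<and> contradictories s2 s3 \<and>
     subaltern s3 s1 \<and> subaltern s4 s2"

definition hexagon_of_opposition ::
  "('w, 'n::finite) sentence \<Rightarrow> ('w, 'n) sentence \<Rightarrow> ('w, 'n) sentence \<Rightarrow> ('w, 'n) sentence \<Rightarrow>
   ('w, 'n) sentence \<Rightarrow> ('w, 'n) sentence \<Rightarrow> bool"
where
  "hexagon_of_opposition s1 s2 s3 s4 s5 s6 \<longleftrightarrow>
     square_of_opposition s1 s2 s3 s4 \<and>
     sequiv s5 (sor s1 s2) \<and> sequiv s6 (sand s3 s4)"

end

theory Submission
  imports Defs
begin

text \<open>
  Fix the family \<open>F\<close>. All four relations see an imprecise assessment only through its coherent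
  part, a subset of the set \<open>W = coherent_part (F, unit_cube)\<close> of coherent points of the cube.
  There they become relations of plain set algebra: being contraries is disjointness, being
  subcontraries is covering \<open>W\<close>, subalternation is inclusion, and being contradictories is
  being complementary in \<open>W\<close>.

  Write \<open>A\<^sub>k\<close> for the coherent part of the \<open>k\<close>-th sentence of a hexagon. The two diagonals of
  the square give \<open>A\<^sub>4 = W - A\<^sub>1\<close> and \<open>A\<^sub>3 = W - A\<^sub>2\<close>. Since \<open>A\<^sub>5 = A\<^sub>1 \<union> A\<^sub>2\<close> and
  \<open>A\<^sub>6 = A\<^sub>3 \<inter> A\<^sub>4\<close>, De Morgan's law gives \<open>A\<^sub>6 = W - A\<^sub>5\<close>: the third diagonal. The other
  relations express that \<open>A\<^sub>1\<close> and \<open>A\<^sub>2\<close> lie in \<open>A\<^sub>5\<close>, passing to complements where needed.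
\<close>

lemma coherent_part_subset_cube:
  assumes "I \<subseteq> unit_cube"
  shows "coherent_part (F, I) \<subseteq> coherent_part (F, unit_cube)"
  using assms by (auto simp: coherent_part_def)

lemma coherent_part_sand:
  "coherent_part (sand (F, I) (F, I')) = coherent_part (F, I) \<inter> coherent_part (F, I')"
  by (auto simp: coherent_part_def sand_def)

lemma coherent_part_sor:
  "coherent_part (sor (F, I) (F, I')) = coherent_part (F, I) \<union> coherent_part (F, I')"
  by (auto simp: coherent_part_def sor_def)

lemma contraries_iff_disjoint:
  "contraries (F, I) (F, I') \<longleftrightarrow> coherent_part (F, I) \<inter> coherent_part (F, I') = {}"
  by (simp add: contraries_def acceptable_def coherent_part_sand)

lemma subcontraries_iff_cover:
  "subcontraries (F, I) (F, I') \<longleftrightarrow>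
     coherent_part (F, unit_cube) \<subseteq> coherent_part (F, I) \<union> coherent_part (F, I')"
  by (auto simp: subcontraries_def acceptable_def coherent_part_def sand_def snot_def)

text \<open>
  Negation is the complement in the cube, so a non-acceptable \<open>s \<and> \<not> s'\<close> only controls the
  points of \<open>s\<close> inside the cube; hence the hypothesis on \<open>I\<close>.
\<close>

lemma subaltern_iff_subset:
  assumes "I \<subseteq> unit_cube"
  shows "subaltern (F, I') (F, I) \<longleftrightarrow> coherent_part (F, I) \<subseteq> coherent_part (F, I')"
  using assms by (auto simp: subaltern_def acceptable_def coherent_part_def sand_def snot_def)

lemma contradictories_iff_complement:
  assumes "I' \<subseteq> unit_cube"
  shows "contradictories (F, I) (F, I') \<longleftrightarrow>
           coherent_part (F, I') = coherent_part (F, unit_cube) - coherent_part (F, I)"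
  using coherent_part_subset_cube[OF assms, of F]
  unfolding contradictories_def contraries_iff_disjoint subcontraries_iff_cover
  by blast

theorem theorem4:
  fixes F :: "('w, 'n::finite) family"
    and I1 I2 I3 I4 I5 I6 :: "(real ^ 'n) set"
    and s1 s2 s3 s4 s5 s6 :: "('w, 'n) sentence"
  assumes "\<forall>i. cond_event (F i)"
    and "s1 = (F, I1)" and "I1 \<subseteq> unit_cube"
    and "s2 = (F, I2)" and "I2 \<subseteq> unit_cube"
    and "s3 = (F, I3)" and "I3 \<subseteq> unit_cube"
    and "s4 = (F, I4)" and "I4 \<subseteq> unit_cube"
    and "s5 = (F, I5)" and "I5 \<subseteq> unit_cube"
    and "s6 = (F, I6)" and "I6 \<subseteq> unit_cube"
    and "hexagon_of_opposition s1 s2 s3 s4 s5 s6"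
  shows
    "(contraries s1 s2 \<and> subcontraries s3 s4 \<and>
      contradictories s1 s4 \<and> contradictories s2 s3 \<and>
      subaltern s3 s1 \<and> subaltern s4 s2) \<and>
     contraries s1 s6 \<and>
     contraries s2 s6 \<and>
     subaltern s3 s6 \<and>
     subaltern s4 s6 \<and>
     subaltern s5 s1 \<and>
     subaltern s5 s2 \<and>
     subcontraries s5 s3 \<and>
     subcontraries s5 s4 \<and>
     contradictories s5 s6"
proof -
  let ?W = "coherent_part (F, unit_cube)"
  let ?A1 = "coherent_part (F, I1)" and ?A2 = "coherent_part (F, I2)"
  let ?A3 = "coherent_part (F, I3)" and ?A4 = "coherent_part (F, I4)"
  let ?A5 = "coherent_part (F, I5)" and ?A6 = "coherent_part (F, I6)"
  note s = assms(2,4,6,8,10,12)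
  note cube = assms(3,5,7,9,11,13)
  have square: "square_of_opposition s1 s2 s3 s4"
    and "sequiv s5 (sor s1 s2)" and "sequiv s6 (sand s3 s4)"
    using assms(14) by (simp_all add: hexagon_of_opposition_def)
  then have A5: "?A5 = ?A1 \<union> ?A2" and "?A6 = ?A3 \<inter> ?A4"
    by (simp_all add: sequiv_def s coherent_part_sand coherent_part_sor)
  have A4: "?A4 = ?W - ?A1" and A3: "?A3 = ?W - ?A2"
    using square
    by (simp_all add: square_of_opposition_def s contradictories_iff_complement cube)
  have A6: "?A6 = ?W - ?A5"
    using \<open>?A6 = ?A3 \<inter> ?A4\<close> A3 A4 A5 by blast
  have "contraries s1 s6" and "contraries s2 s6"
    using A5 A6 by (auto simp: s contraries_iff_disjoint)
  moreover have "subaltern s3 s6" and "subaltern s4 s6"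
    using A3 A4 A5 A6 by (auto simp: s subaltern_iff_subset cube)
  moreover have "subaltern s5 s1" and "subaltern s5 s2"
    using A5 by (auto simp: s subaltern_iff_subset cube)
  moreover have "subcontraries s5 s3" and "subcontraries s5 s4"
    using A3 A4 A5 by (auto simp: s subcontraries_iff_cover)
  moreover have "contradictories s5 s6"
    using A6 by (simp add: s contradictories_iff_complement cube)
  ultimately show ?thesis
    using square by (simp add: square_of_opposition_def)
qed

end
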